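(* Consider estimating a unimodal spherically symmetric Lebesgue density $q_Y(\|y-\mu\|^2)$, $y\in\mathbb{R}^p$, $\mu\in\mathbb{R}^p$, under integrated $L_1$ loss and based on $X\sim p_X(\|x-\mu\|^2)$. The frequentist risk of the plug-in density estimator $q_Y(\|y-\hat\mu(X)\|^2)$ is equal to the frequentist risk of the point estimator $\hat\mu(X)$ of $\mu$ under the loss $4F\left(\frac{\|\hat\mu-\mu\|}{2}\right)-2$, with $F$ being the common marginal cdf associated with $q_Y$. Consequently, $q_Y(\|y-\hat\mu_1(X)\|^2)$ dominates $q_Y(\|y-\hat\mu_2(X)\|^2)$ if and only if $\hat\mu_1(X)$ dominates $\hat\mu_2(X)$ under the loss $2F\left(\frac{\|\hat\mu-\mu\|}{2}\right)-1$.
   Context: Here $F(t)=P(Y_1\le t)$ where $Y=(Y_1,\dots,Y_p)'$ has density $q_Y(\|y\|^2)$ (i.e. $\mu=0$). The integrated $L_1$ loss of an estimate $\hat q(\cdot;x)$ is $\int_{\mathbb{R}^p}|q_Y(\|y-\mu\|^2)-\hat q(y;x)|\,dy$; risk is the expectation over $X$. One estimator dominates another if its risk is $\le$ for all $\mu$ with strict inequality for some $\mu$ (same definition for point estimators under a given loss). Unimodal means that the density $q_Y(\|y\|^2)$ is a non-increasing function of $\|y\|$. *)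

theory Defs
  imports "HOL-Probability.Probability"
begin

definition lebesgue_density :: "('a::euclidean_space \<Rightarrow> real) \<Rightarrow> bool" where
  "lebesgue_density f \<longleftrightarrow>
     f \<in> borel_measurable borel \<and> (\<forall>y. 0 \<le> f y) \<and> (\<integral>\<^sup>+y. ennreal (f y) \<partial>lborel) = 1"

definition spherical :: "(real \<Rightarrow> real) \<Rightarrow> 'a::euclidean_space \<Rightarrow> 'a \<Rightarrow> real" where
  "spherical q \<mu> y = q ((norm (y - \<mu>))\<^sup>2)"

definition spherical_measure :: "(real \<Rightarrow> real) \<Rightarrow> 'a::euclidean_space \<Rightarrow> 'a measure" where
  "spherical_measure q \<mu> = density lborel (\<lambda>y. ennreal (spherical q \<mu> y))"

(* The origin is exempt: densities here are real-valued, so a unimodal density with a pole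
   at the centre carries an arbitrary value at that single point. *)
definition unimodal :: "('a::euclidean_space \<Rightarrow> real) \<Rightarrow> bool" where
  "unimodal f \<longleftrightarrow> (\<forall>y z. 0 < norm y \<and> norm y \<le> norm z \<longrightarrow> f z \<le> f y)"

(* By spherical symmetry the result does not depend on the coordinate k. *)
definition marginal_cdf :: "(real \<Rightarrow> real) \<Rightarrow> 'n::finite \<Rightarrow> real \<Rightarrow> real" where
  "marginal_cdf q k =
     cdf (distr (spherical_measure q (0 :: real ^ 'n)) borel (\<lambda>y. y $ k))"

(* P \<theta> is the law of the observation, L \<theta> d the loss of the decision d. *)
definition risk ::
  "('t \<Rightarrow> 'x measure) \<Rightarrow> ('t \<Rightarrow> 'd \<Rightarrow> ennreal) \<Rightarrow> ('x \<Rightarrow> 'd) \<Rightarrow> 't \<Rightarrow> ennreal" where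
  "risk P L \<delta> \<theta> = (\<integral>\<^sup>+x. L \<theta> (\<delta> x) \<partial>P \<theta>)"

definition dominates ::
  "('t \<Rightarrow> 'x measure) \<Rightarrow> ('t \<Rightarrow> 'd \<Rightarrow> ennreal) \<Rightarrow> ('x \<Rightarrow> 'd) \<Rightarrow> ('x \<Rightarrow> 'd) \<Rightarrow> bool" where
  "dominates P L \<delta>1 \<delta>2 \<longleftrightarrow>
     (\<forall>\<theta>. risk P L \<delta>1 \<theta> \<le> risk P L \<delta>2 \<theta>) \<and> (\<exists>\<theta>. risk P L \<delta>1 \<theta> < risk P L \<delta>2 \<theta>)"

definition L1_loss ::
  "(real \<Rightarrow> real) \<Rightarrow> 'a::euclidean_space \<Rightarrow> ('a \<Rightarrow> real) \<Rightarrow> ennreal" where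
  "L1_loss q \<mu> g = (\<integral>\<^sup>+y. ennreal \<bar>spherical q \<mu> y - g y\<bar> \<partial>lborel)"

definition plug_in ::
  "(real \<Rightarrow> real) \<Rightarrow> ('a::euclidean_space \<Rightarrow> 'a) \<Rightarrow> 'a \<Rightarrow> 'a \<Rightarrow> real" where
  "plug_in q m x = spherical q (m x)"

(* Truncation by ennreal is not active for (a, b) = (4, 2) or (2, 1): a symmetric marginal
   satisfies F t \<ge> 1/2 for t \<ge> 0. *)
definition cdf_loss ::
  "real \<Rightarrow> real \<Rightarrow> (real \<Rightarrow> real) \<Rightarrow> 'a::real_normed_vector \<Rightarrow> 'a \<Rightarrow> ennreal" where
  "cdf_loss a b F \<mu> d = ennreal (a * F (norm (d - \<mu>) / 2) - b)"

end

theory Submission imports Defs begin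

text \<open>
  The equality of risks already holds for each observation: the \<open>L\<^sub>1\<close> distance between two
  translates of the unimodal spherical density, centred at \<open>\<mu>\<close> and \<open>d\<close>, is
  \<open>4 F(r/2) - 2\<close> with \<open>r = \<parallel>d - \<mu>\<parallel>\<close> (lemma \<open>L1_loss_spherical_eq_cdf_loss\<close>).

  By unimodality the translate with the nearer centre is at least as large as the other, so the
  density centred at \<open>\<mu>\<close> is the larger one on the half-space \<open>A\<close> on its side of the
  perpendicular bisector of the two centres, and the smaller one off \<open>A\<close>. As both functions are probability densities, the positive and the negative part of
  their difference have the same integral, and the \<open>L\<^sub>1\<close> distance is twice the difference of the
  two probabilities of \<open>A\<close> (\<open>L1_distance_eq_dominance_set\<close>). The bisector lies at distance \<open>r/2\<close>
  from either centre, in direction \<open>u = (d - \<mu>)/r\<close> from \<open>\<mu>\<close> and in direction \<open>-u\<close> from \<open>d\<close>;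
  hence the two probabilities are the values at \<open>r/2\<close> and at \<open>-r/2\<close> of the cdf of the
  projection of a centred vector on \<open>u\<close>. Spherical symmetry makes this cdf the marginal
  cdf \<open>F\<close>, whatever \<open>u\<close> is, and gives \<open>F(-t) = 1 - F(t)\<close>. The distance is therefore
  \<open>2 (F(r/2) - F(-r/2)) = 4 F(r/2) - 2\<close>.

  Domination is compared through risks only, and the loss \<open>4F - 2\<close> is twice the loss \<open>2F - 1\<close>;
  a positive finite factor preserves both \<open>\<le>\<close> and \<open><\<close> between extended nonnegative risks.
\<close>

section \<open>Orthogonal invariance of Lebesgue measure\<close>

lemma nn_integral_lborel_translate:
  fixes g :: "'a::euclidean_space \<Rightarrow> ennreal"
  assumes [measurable]: "g \<in> borel_measurable borel"
  shows "(\<integral>\<^sup>+y. g (c + y) \<partial>lborel) = (\<integral>\<^sup>+y. g y \<partial>lborel)"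
proof -
  have "(\<integral>\<^sup>+y. g y \<partial>lborel) = (\<integral>\<^sup>+y. g y \<partial>distr lborel borel ((+) c))"
    by (simp add: lborel_distr_plus)
  also have "\<dots> = (\<integral>\<^sup>+y. g (c + y) \<partial>lborel)"
    by (subst nn_integral_distr) auto
  finally show ?thesis ..
qed

lemma measurable_orthogonal_transformation:
  fixes f :: "'a::euclidean_space \<Rightarrow> 'a"
  assumes "orthogonal_transformation f"
  shows "f \<in> borel_measurable borel"
  using assms
  by (intro borel_measurable_continuous_onI linear_continuous_on linear_conv_bounded_linear[THEN iffD1])
     (simp add: orthogonal_transformation_linear)

text \<open>
  The image of Lebesgue measure under \<open>f\<close> is again translation invariant, and a locally finite
  translation invariant measure is determined up to a factor; the factor is 1 because \<open>f\<close> preserves the unit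
  ball \<open>B\<close>. Both points are settled at once by evaluating, in the two orders of integration,
  the double integral of \<open>1\<^sub>B(x) 1\<^sub>A(x + f y)\<close>: integrating over \<open>y\<close> first gives the volume of
  \<open>B\<close> times that of the preimage of \<open>A\<close>, whereas the substitution \<open>x \<mapsto> x - f y\<close> turns it into
  the volume of \<open>B\<close> times that of \<open>A\<close>.
\<close>
lemma lborel_distr_orthogonal_transformation:
  fixes f :: "'a::euclidean_space \<Rightarrow> 'a"
  assumes f: "orthogonal_transformation f"
  shows "distr lborel borel f = lborel"
proof (rule measure_eqI)
  show "sets (distr lborel borel f) = sets lborel" by simp
next
  fix A assume "A \<in> sets (distr lborel borel f)"
  then have A[measurable]: "A \<in> sets borel" by simp
  note [measurable] = measurable_orthogonal_transformation[OF f]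
  define B where "B = ball (0::'a) 1"
  have [measurable]: "B \<in> sets borel" by (simp add: B_def)
  define L where "L = emeasure lborel B"
  have fadd: "f (x + y) = f x + f y" for x y
    using f by (simp add: orthogonal_transformation_linear linear_add)
  have finv: "f (inv f x) = x" for x
    using orthogonal_transformation_surj[OF f] by (simp add: surj_f_inv_f)
  have shift: "(\<integral>\<^sup>+y. indicator A (x + f y) \<partial>lborel) = emeasure lborel (f -` A)" for x
  proof -
    have "(\<integral>\<^sup>+y. indicator A (x + f y) \<partial>lborel) = (\<integral>\<^sup>+y. indicator A (f (inv f x + y)) \<partial>lborel)"
      by (simp add: fadd finv)
    also have "\<dots> = (\<integral>\<^sup>+y. indicator A (f y) \<partial>lborel)"
      by (rule nn_integral_lborel_translate[where g="\<lambda>y. indicator A (f y)"]) measurable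
    also have "\<dots> = (\<integral>\<^sup>+y. indicator (f -` A) y \<partial>lborel)"
      by (intro nn_integral_cong) (auto simp: indicator_def)
    also have "\<dots> = emeasure lborel (f -` A)"
      using measurable_sets[OF measurable_orthogonal_transformation[OF f] A]
      by (subst nn_integral_indicator) auto
    finally show ?thesis .
  qed
  have ball: "(\<integral>\<^sup>+y. indicator B (x - f y) \<partial>lborel) = L" for x
  proof -
    have "x - f y \<in> B \<longleftrightarrow> y - inv f x \<in> B" for y
    proof -
      have "x - f y = f (inv f x - y)"
        using f by (simp add: orthogonal_transformation_linear linear_diff finv)
      then have "norm (x - f y) = norm (y - inv f x)"
        by (metis f orthogonal_transformation_norm norm_minus_commute)
      then show ?thesis by (simp add: B_def)
    qed
    then have "(\<integral>\<^sup>+y. indicator B (x - f y) \<partial>lborel) = (\<integral>\<^sup>+y. indicator B (- inv f x + y) \<partial>lborel)"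
      by (intro nn_integral_cong) (auto simp: indicator_def)
    also have "\<dots> = (\<integral>\<^sup>+y. indicator B y \<partial>lborel)"
      by (rule nn_integral_lborel_translate) measurable
    finally show ?thesis by (simp add: L_def)
  qed
  have "L * emeasure lborel (f -` A)
      = (\<integral>\<^sup>+x. indicator B x * emeasure lborel (f -` A) \<partial>lborel)"
    by (subst nn_integral_multc) (auto simp: L_def)
  also have "\<dots> = (\<integral>\<^sup>+x. (\<integral>\<^sup>+y. indicator B x * indicator A (x + f y) \<partial>lborel) \<partial>lborel)"
    by (subst nn_integral_cmult) (auto simp: shift)
  also have "\<dots> = (\<integral>\<^sup>+y. (\<integral>\<^sup>+x. indicator B x * indicator A (x + f y) \<partial>lborel) \<partial>lborel)"
    by (rule lborel_pair.Fubini'[symmetric]) measurable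
  also have "\<dots> = (\<integral>\<^sup>+y. (\<integral>\<^sup>+x. indicator B (x - f y) * indicator A x \<partial>lborel) \<partial>lborel)"
  proof (rule nn_integral_cong)
    fix y
    show "(\<integral>\<^sup>+x. indicator B x * indicator A (x + f y) \<partial>lborel)
        = (\<integral>\<^sup>+x. indicator B (x - f y) * indicator A x \<partial>lborel)"
      using nn_integral_lborel_translate[of "\<lambda>x. indicator B (x - f y) * indicator A x" "f y"]
      by (simp add: add.commute)
  qed
  also have "\<dots> = (\<integral>\<^sup>+x. (\<integral>\<^sup>+y. indicator B (x - f y) * indicator A x \<partial>lborel) \<partial>lborel)"
    by (rule lborel_pair.Fubini') measurable
  also have "\<dots> = (\<integral>\<^sup>+x. L * indicator A x \<partial>lborel)"
    by (subst nn_integral_multc) (auto simp: ball)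
  also have "\<dots> = L * emeasure lborel A"
    by (subst nn_integral_cmult) auto
  finally have "L * emeasure lborel (f -` A) = L * emeasure lborel A" .
  moreover have "unit_ball_vol (real DIM('a)) \<noteq> 0"
    using unit_ball_vol_pos[of "real DIM('a)"] by linarith
  then have "L \<noteq> 0" "L \<noteq> top"
    using emeasure_lborel_ball_finite[of "0::'a" 1]
    by (auto simp: L_def B_def emeasure_ball less_top[symmetric])
  ultimately have "emeasure lborel (f -` A) = emeasure lborel A"
    by (auto simp: ennreal_mult_cancel_left)
  then show "emeasure (distr lborel borel f) A = emeasure lborel A"
    by (subst emeasure_distr) auto
qed

section \<open>Spherically symmetric laws\<close>

lemma borel_measurable_spherical:
  fixes \<mu> :: "'a::euclidean_space"
  assumes "lebesgue_density (spherical q (0::'a))"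
  shows "spherical q \<mu> \<in> borel_measurable borel"
proof -
  have [measurable]: "spherical q (0::'a) \<in> borel_measurable borel"
    using assms by (simp add: lebesgue_density_def)
  have "(\<lambda>y. spherical q 0 (y - \<mu>)) \<in> borel_measurable borel"
    by measurable
  then show ?thesis by (simp add: spherical_def[abs_def])
qed

lemma distr_spherical_measure_translate:
  fixes \<mu> :: "'a::euclidean_space"
  assumes "lebesgue_density (spherical q (0::'a))"
  shows "distr (spherical_measure q 0) borel ((+) \<mu>) = spherical_measure q \<mu>"
proof -
  note [measurable] = borel_measurable_spherical[OF assms]
  have "spherical_measure q \<mu> = density (distr lborel borel ((+) \<mu>)) (\<lambda>y. ennreal (spherical q \<mu> y))"
    by (simp add: spherical_measure_def lborel_distr_plus)
  also have "\<dots> = distr (density lborel (\<lambda>y. ennreal (spherical q \<mu> (\<mu> + y)))) borel ((+) \<mu>)"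
    by (rule density_distr) measurable
  finally show ?thesis
    by (simp add: spherical_measure_def spherical_def)
qed

lemma distr_spherical_measure_orthogonal:
  fixes f :: "'a::euclidean_space \<Rightarrow> 'a"
  assumes "lebesgue_density (spherical q (0::'a))" and f: "orthogonal_transformation f"
  shows "distr (spherical_measure q 0) borel f = spherical_measure q 0"
proof -
  note [measurable] = borel_measurable_spherical[OF assms(1)] measurable_orthogonal_transformation[OF f]
  have "spherical_measure q (0::'a) = density (distr lborel borel f) (\<lambda>y. ennreal (spherical q 0 y))"
    by (simp add: spherical_measure_def lborel_distr_orthogonal_transformation[OF f])
  also have "\<dots> = distr (density lborel (\<lambda>y. ennreal (spherical q 0 (f y)))) borel f"
    by (rule density_distr) measurable
  finally show ?thesis
    by (simp add: spherical_measure_def spherical_def orthogonal_transformation_norm[OF f])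
qed

lemma prob_space_spherical_measure:
  fixes \<mu> :: "'a::euclidean_space"
  assumes "lebesgue_density (spherical q (0::'a))"
  shows "prob_space (spherical_measure q \<mu>)"
proof -
  have "prob_space (spherical_measure q (0::'a))"
    using assms
    by (intro prob_spaceI) (auto simp: spherical_measure_def lebesgue_density_def emeasure_density)
  then have "prob_space (distr (spherical_measure q 0) borel ((+) \<mu>))"
    by (rule prob_space.prob_space_distr) (auto simp: spherical_measure_def)
  then show ?thesis by (simp add: distr_spherical_measure_translate[OF assms])
qed

lemma sets_spherical_measure [simp, measurable_cong]: "sets (spherical_measure q \<mu>) = sets borel"
  by (simp add: spherical_measure_def)

lemma space_spherical_measure [simp]: "space (spherical_measure q \<mu>) = UNIV"
  by (simp add: spherical_measure_def)

definition halfspace_prob :: "(real \<Rightarrow> real) \<Rightarrow> 'a::euclidean_space \<Rightarrow> real \<Rightarrow> real" where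
  "halfspace_prob q u t = measure (spherical_measure q 0) {y. u \<bullet> y \<le> t}"

lemma halfspace_prob_translate:
  fixes u :: "'a::euclidean_space"
  assumes "lebesgue_density (spherical q (0::'a))"
  shows "measure (spherical_measure q \<mu>) {y. u \<bullet> y \<le> t} = halfspace_prob q u (t - u \<bullet> \<mu>)"
proof -
  have "measure (spherical_measure q \<mu>) {y. u \<bullet> y \<le> t}
      = measure (distr (spherical_measure q 0) borel ((+) \<mu>)) {y. u \<bullet> y \<le> t}"
    by (simp add: distr_spherical_measure_translate[OF assms])
  also have "\<dots> = measure (spherical_measure q 0) {y. u \<bullet> (\<mu> + y) \<le> t}"
    by (subst measure_distr) (auto simp: vimage_def)
  also have "{y. u \<bullet> (\<mu> + y) \<le> t} = {y. u \<bullet> y \<le> t - u \<bullet> \<mu>}"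
    by (auto simp: inner_add_right)
  finally show ?thesis by (simp add: halfspace_prob_def)
qed

lemma halfspace_prob_orthogonal:
  fixes f :: "'a::euclidean_space \<Rightarrow> 'a"
  assumes "lebesgue_density (spherical q (0::'a))" and f: "orthogonal_transformation f"
  shows "halfspace_prob q (f u) t = halfspace_prob q u t"
proof -
  note [measurable] = measurable_orthogonal_transformation[OF f]
  have "halfspace_prob q (f u) t
      = measure (distr (spherical_measure q 0) borel f) {y. f u \<bullet> y \<le> t}"
    by (simp add: distr_spherical_measure_orthogonal[OF assms] halfspace_prob_def)
  also have "\<dots> = measure (spherical_measure q 0) {y. f u \<bullet> f y \<le> t}"
    by (subst measure_distr) (auto simp: vimage_def)
  also have "\<dots> = halfspace_prob q u t"
    using f by (simp add: orthogonal_transformation_def halfspace_prob_def)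
  finally show ?thesis .
qed

text \<open>
  The reflection \<open>y \<mapsto> -y\<close> is orthogonal and carries the half-space \<open>u \<bullet> y \<le> -t\<close> to
  \<open>u \<bullet> y \<ge> t\<close>, which is the complement of \<open>u \<bullet> y \<le> t\<close> up to a hyperplane of measure zero.
\<close>
lemma halfspace_prob_minus:
  fixes u :: "'a::euclidean_space"
  assumes "lebesgue_density (spherical q (0::'a))" and "u \<noteq> 0"
  shows "halfspace_prob q u (- t) = 1 - halfspace_prob q u t"
proof -
  note [measurable] = borel_measurable_spherical[OF assms(1)]
  interpret P: prob_space "spherical_measure q (0::'a)"
    by (rule prob_space_spherical_measure[OF assms(1)])
  have null: "AE y in spherical_measure q 0. u \<bullet> y \<noteq> t"
  proof -
    have "{y. u \<bullet> y = t} \<in> null_sets lborel"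
      using negligible_hyperplane[of u t] assms(2)
      by (simp add: negligible_iff_null_sets null_sets_completion_iff)
    then have "AE y in lborel. u \<bullet> y \<noteq> t"
      by (rule AE_I'[where N="{y. u \<bullet> y = t}"]) auto
    then show ?thesis
      unfolding spherical_measure_def by (subst AE_density) auto
  qed
  have "halfspace_prob q u (- t) = halfspace_prob q (- u) (- t)"
    using halfspace_prob_orthogonal[OF assms(1), of uminus u "-t"]
      orthogonal_transformation_neg[of "\<lambda>x::'a. x"] by simp
  also have "\<dots> = P.prob {y. t \<le> u \<bullet> y}"
    by (simp add: halfspace_prob_def)
  also have "\<dots> = P.prob (UNIV - {y. u \<bullet> y \<le> t})"
    using null by (intro P.finite_measure_eq_AE) (auto elim!: eventually_mono)
  also have "\<dots> = 1 - halfspace_prob q u t"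
    using P.prob_compl[of "{y. u \<bullet> y \<le> t}"] by (simp add: halfspace_prob_def)
  finally show ?thesis .
qed

text \<open>
  Some orthogonal map carries the coordinate vector to \<open>u\<close>, so the projection on \<open>u\<close> has the law
  of a single coordinate.
\<close>
lemma halfspace_prob_eq_marginal_cdf:
  fixes u :: "real ^ 'n"
  assumes "lebesgue_density (spherical q (0 :: real ^ 'n))" and "norm u = 1"
  shows "halfspace_prob q u t = marginal_cdf q (k::'n::finite) t"
proof -
  have "norm (axis k (1::real)) = 1" by simp
  then obtain f :: "real ^ 'n \<Rightarrow> real ^ 'n" where f: "orthogonal_transformation f" "f (axis k 1) = u"
    using orthogonal_transformation_exists_1[OF _ assms(2)] by metis
  have "halfspace_prob q u t = halfspace_prob q (axis k (1::real)) t"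
    using halfspace_prob_orthogonal[OF assms(1) f(1), of "axis k 1" t] f(2) by simp
  also have "\<dots> = marginal_cdf q k t"
    unfolding marginal_cdf_def cdf_def halfspace_prob_def
    by (subst measure_distr) (auto simp: vimage_def inner_axis' )
  finally show ?thesis .
qed

lemma marginal_cdf_minus:
  fixes k :: "'n::finite"
  assumes "lebesgue_density (spherical q (0 :: real ^ 'n))"
  shows "marginal_cdf q k (- t) = 1 - marginal_cdf q k t"
  using halfspace_prob_minus[OF assms, of "axis k 1" t]
    halfspace_prob_eq_marginal_cdf[OF assms, of "axis k 1"]
  by (auto simp: axis_eq_0_iff)

lemma borel_measurable_marginal_cdf:
  fixes k :: "'n::finite"
  assumes "lebesgue_density (spherical q (0 :: real ^ 'n))"
  shows "marginal_cdf q k \<in> borel_measurable borel"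
proof -
  interpret P: prob_space "spherical_measure q (0::real^'n)"
    by (rule prob_space_spherical_measure[OF assms])
  interpret D: real_distribution "distr (spherical_measure q (0::real^'n)) borel (\<lambda>y. y $ k)"
    by (rule P.real_distribution_distr) measurable
  show ?thesis
    unfolding marginal_cdf_def
    by (rule borel_measurable_mono) (auto intro!: monoI D.cdf_nondecreasing)
qed

section \<open>The loss of the plug-in density\<close>

text \<open>
  Scheffe's identity. Where \<open>f - g\<close> is nonnegative on \<open>A\<close> and nonpositive off \<open>A\<close>, its absolute
  value is \<open>(f - g)(2\<cdot>1\<^sub>A - 1)\<close>, and \<open>f - g\<close> itself integrates to \<open>1 - 1 = 0\<close>.
\<close>
lemma L1_distance_eq_dominance_set:
  fixes f g :: "'b \<Rightarrow> real"
  assumes [measurable]: "f \<in> borel_measurable M" "g \<in> borel_measurable M" "A \<in> sets M"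
    and nonneg: "\<And>y. 0 \<le> f y" "\<And>y. 0 \<le> g y"
    and prob: "prob_space (density M (\<lambda>y. ennreal (f y)))" "prob_space (density M (\<lambda>y. ennreal (g y)))"
    and le: "AE y in M. y \<in> A \<longrightarrow> g y \<le> f y" and ge: "AE y in M. y \<notin> A \<longrightarrow> f y \<le> g y"
  shows "(\<integral>\<^sup>+y. ennreal \<bar>f y - g y\<bar> \<partial>M) =
    ennreal (2 * (measure (density M (\<lambda>y. ennreal (f y))) A - measure (density M (\<lambda>y. ennreal (g y))) A))"
proof -
  have int: "integrable M h \<and> (\<integral>y. h y \<partial>M) = 1 \<and>
      measure (density M (\<lambda>y. ennreal (h y))) A = (\<integral>y. h y * indicator A y \<partial>M)"
    if [measurable]: "h \<in> borel_measurable M" and nn: "\<And>y. 0 \<le> h y"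
      and ps: "prob_space (density M (\<lambda>y. ennreal (h y)))" for h :: "'b \<Rightarrow> real"
  proof -
    have one: "(\<integral>\<^sup>+y. ennreal (h y) \<partial>M) = ennreal 1"
      using prob_space.emeasure_space_1[OF ps] by (simp add: emeasure_density cong: nn_integral_cong)
    have "integrable M h \<and> (\<integral>y. h y \<partial>M) = 1"
      using nn_integral_eq_integrable[of h M 1] one nn by auto
    moreover have "measure (density M (\<lambda>y. ennreal (h y))) A
        = (\<integral>y. indicator A y \<partial>density M (\<lambda>y. ennreal (h y)))"
      using sets.sets_into_space[OF assms(3)] by (simp add: Int_absorb2)
    moreover have "\<dots> = (\<integral>y. h y * indicator A y \<partial>M)"
      using nn by (subst integral_density) auto
    ultimately show ?thesis by simp
  qed
  note F = int[OF assms(1) nonneg(1) prob(1)] and G = int[OF assms(2) nonneg(2) prob(2)]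
  have [simp]: "integrable M f" "integrable M g"
    "integrable M (\<lambda>y. f y * indicator A y)" "integrable M (\<lambda>y. g y * indicator A y)"
    using F G by (auto intro!: integrable_real_mult_indicator)
  have "(\<integral>\<^sup>+y. ennreal \<bar>f y - g y\<bar> \<partial>M) = ennreal (\<integral>y. \<bar>f y - g y\<bar> \<partial>M)"
    by (rule nn_integral_eq_integral) auto
  also have "(\<integral>y. \<bar>f y - g y\<bar> \<partial>M)
      = (\<integral>y. 2 * (f y * indicator A y - g y * indicator A y) - (f y - g y) \<partial>M)"
    using le ge by (intro integral_cong_AE) (auto simp: indicator_def)
  also have "\<dots> = 2 * ((\<integral>y. f y * indicator A y \<partial>M) - (\<integral>y. g y * indicator A y \<partial>M))"
    using F G by simp
  finally show ?thesis using F G by simp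
qed

text \<open>
  Subtracting the squared distances cancels the quadratic term in \<open>y\<close>: the points nearer to \<open>\<mu>\<close>
  form the half-space on its side of the perpendicular bisector.
\<close>
lemma norm_diff_le_iff_halfspace:
  fixes u :: "'a::real_inner"
  assumes u: "norm u = 1" and d: "d - \<mu> = r *\<^sub>R u" and r: "r > 0"
  shows "norm (y - \<mu>) \<le> norm (y - d) \<longleftrightarrow> u \<bullet> y \<le> u \<bullet> \<mu> + r / 2"
proof -
  have yd: "y - d = (y - \<mu>) - r *\<^sub>R u" using d by (simp add: algebra_simps)
  have uu: "u \<bullet> u = 1" using u by (simp add: dot_square_norm)
  have "(norm (z - r *\<^sub>R u))\<^sup>2 = (norm z)\<^sup>2 - 2 * r * (u \<bullet> z) + r\<^sup>2" for z
    unfolding power2_norm_eq_inner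
    by (simp add: uu inner_diff_left inner_diff_right inner_commute[of z u] right_diff_distrib power2_eq_square)
  then have sq: "(norm (y - d))\<^sup>2 = (norm (y - \<mu>))\<^sup>2 - 2 * r * (u \<bullet> (y - \<mu>)) + r\<^sup>2"
    unfolding yd .
  have "norm (y - \<mu>) \<le> norm (y - d) \<longleftrightarrow> (norm (y - \<mu>))\<^sup>2 \<le> (norm (y - d))\<^sup>2"
    by (simp add: abs_le_square_iff[symmetric])
  also have "\<dots> \<longleftrightarrow> r * (2 * (u \<bullet> (y - \<mu>))) \<le> r * r"
    unfolding sq by (auto simp: power2_eq_square mult_ac)
  also have "\<dots> \<longleftrightarrow> 2 * (u \<bullet> (y - \<mu>)) \<le> r" using r by simp
  also have "\<dots> \<longleftrightarrow> u \<bullet> y \<le> u \<bullet> \<mu> + r / 2"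
    by (auto simp: inner_diff_right)
  finally show ?thesis .
qed

text \<open>
  For \<open>d = \<mu>\<close> there is no bisector; both sides vanish because symmetry gives \<open>F(0) = 1/2\<close>.
\<close>
lemma L1_loss_spherical_eq_cdf_loss:
  fixes \<mu> d :: "real ^ 'n" and k :: "'n::finite"
  assumes dens: "lebesgue_density (spherical q (0 :: real ^ 'n))"
    and unim: "unimodal (spherical q (0 :: real ^ 'n))"
  shows "L1_loss q \<mu> (spherical q d) = cdf_loss 4 2 (marginal_cdf q k) \<mu> d"
proof (cases "d = \<mu>")
  case True
  have "marginal_cdf q k 0 = 1 / 2"
    using marginal_cdf_minus[OF dens, of k 0] by simp
  with True show ?thesis by (simp add: L1_loss_def cdf_loss_def)
next
  case False
  note [measurable] = borel_measurable_spherical[OF dens]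
  define r where "r = norm (d - \<mu>)"
  define u where "u = (1 / r) *\<^sub>R (d - \<mu>)"
  define A where "A = {y. u \<bullet> y \<le> u \<bullet> \<mu> + r / 2}"
  have r: "r > 0" and u: "norm u = 1" and d: "d - \<mu> = r *\<^sub>R u"
    using False by (auto simp: r_def u_def)
  have A: "y \<in> A \<longleftrightarrow> norm (y - \<mu>) \<le> norm (y - d)" for y
    using norm_diff_le_iff_halfspace[OF u d r] by (simp add: A_def)
  have decr: "spherical q b y \<le> spherical q a y" if "y \<noteq> a" "norm (y - a) \<le> norm (y - b)"
    for a b y :: "real ^ 'n"
    using unim that unfolding unimodal_def spherical_def
    by (metis diff_0_right zero_less_norm_iff right_minus_eq)
  have nn: "0 \<le> spherical q a y" for a y :: "real ^ 'n"
  proof -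
    have "spherical q a y = spherical q 0 (y - a)" by (simp add: spherical_def)
    then show ?thesis using dens by (simp add: lebesgue_density_def)
  qed
  have "L1_loss q \<mu> (spherical q d) =
      ennreal (2 * (measure (spherical_measure q \<mu>) A - measure (spherical_measure q d) A))"
    unfolding L1_loss_def spherical_measure_def
  proof (rule L1_distance_eq_dominance_set)
    show "prob_space (density lborel (\<lambda>y. ennreal (spherical q a y)))" for a :: "real ^ 'n"
      using prob_space_spherical_measure[OF dens, of a] by (simp add: spherical_measure_def)
    then show "prob_space (density lborel (\<lambda>y. ennreal (spherical q d y)))" .
    \<comment> \<open>Unimodality says nothing about the value at the centre, hence the two exceptional points.\<close>
    show "AE y in lborel. y \<in> A \<longrightarrow> spherical q d y \<le> spherical q \<mu> y"
      using AE_lborel_singleton[of \<mu>] by eventually_elim (auto simp: A intro: decr)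
    show "AE y in lborel. y \<notin> A \<longrightarrow> spherical q \<mu> y \<le> spherical q d y"
      using AE_lborel_singleton[of d] by eventually_elim (auto simp: A intro: decr)
    show "A \<in> sets lborel" unfolding A_def by simp
  qed (auto simp: nn)
  also have "measure (spherical_measure q \<mu>) A = marginal_cdf q k (r / 2)"
    by (simp add: A_def halfspace_prob_translate[OF dens] halfspace_prob_eq_marginal_cdf[OF dens u])
  also have "measure (spherical_measure q d) A = marginal_cdf q k (- (r / 2))"
  proof -
    have "u \<bullet> d - u \<bullet> \<mu> = r"
      using u by (simp add: d inner_diff_right[symmetric] dot_square_norm)
    then have "u \<bullet> \<mu> + r / 2 - u \<bullet> d = - (r / 2)" by simp
    then show ?thesis
      by (simp only: A_def halfspace_prob_translate[OF dens]
          halfspace_prob_eq_marginal_cdf[OF dens u, of _ k])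
  qed
  finally show ?thesis
    by (simp add: marginal_cdf_minus[OF dens] cdf_loss_def r_def algebra_simps)
qed

section \<open>Risks and domination\<close>

theorem corollary5p1:
  fixes qY pX :: "real \<Rightarrow> real" and k :: "'n::finite"
  assumes "lebesgue_density (spherical qY (0 :: real ^ 'n))"
    and "unimodal (spherical qY (0 :: real ^ 'n))"
    and "lebesgue_density (spherical pX (0 :: real ^ 'n))"
  shows "(\<forall>m \<in> borel_measurable borel. \<forall>\<mu> :: real ^ 'n.
            risk (spherical_measure pX) (L1_loss qY) (plug_in qY m) \<mu> =
            risk (spherical_measure pX) (cdf_loss 4 2 (marginal_cdf qY k)) m \<mu>) \<and>
         (\<forall>m1 \<in> borel_measurable borel. \<forall>m2 \<in> borel_measurable borel.
            dominates (spherical_measure pX :: real ^ 'n \<Rightarrow> (real ^ 'n) measure)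
              (L1_loss qY) (plug_in qY m1) (plug_in qY m2) \<longleftrightarrow>
            dominates (spherical_measure pX) (cdf_loss 2 1 (marginal_cdf qY k)) m1 m2)"
proof -
  let ?P = "spherical_measure pX :: real ^ 'n \<Rightarrow> (real ^ 'n) measure"
  let ?F = "marginal_cdf qY k"
  note [measurable] = borel_measurable_marginal_cdf[OF assms(1), of k]
  have eq: "risk ?P (L1_loss qY) (plug_in qY m) \<mu> = risk ?P (cdf_loss 4 2 ?F) m \<mu>" for m \<mu>
    unfolding risk_def plug_in_def
    by (simp add: L1_loss_spherical_eq_cdf_loss[OF assms(1,2), of _ _ k])
  have double: "cdf_loss 4 2 ?F \<mu> a = 2 * cdf_loss 2 1 ?F \<mu> a" for \<mu> a :: "real ^ 'n"
  proof -
    have "ennreal (4 * t - 2) = 2 * ennreal (2 * t - 1)" for t :: real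
      using ennreal_mult'[of 2 "2 * t - 1"] by simp
    then show ?thesis unfolding cdf_loss_def .
  qed
  have half: "risk ?P (L1_loss qY) (plug_in qY m) \<mu> = 2 * risk ?P (cdf_loss 2 1 ?F) m \<mu>"
    if [measurable]: "m \<in> borel_measurable borel" for m \<mu>
  proof -
    have "(\<lambda>x. cdf_loss 2 1 ?F \<mu> (m x)) \<in> borel_measurable (?P \<mu>)"
      unfolding cdf_loss_def by measurable
    then show ?thesis
      unfolding eq unfolding risk_def double by (rule nn_integral_cmult)
  qed
  have le: "2 * a \<le> 2 * b \<longleftrightarrow> a \<le> b" for a b :: ennreal
    by (rule ennreal_mult_le_mult_iff) auto
  have less: "2 * a < 2 * b \<longleftrightarrow> a < b" for a b :: ennreal
    using le[of b a] by (simp add: not_le[symmetric])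
  show ?thesis
    by (auto simp: eq[symmetric]) (auto simp: dominates_def half le less)
qed

end
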